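(* Let $m\ge 3$ be an odd integer. Then for every $n\ge 0$, \[ p_m(n,-1)=(-1)^n p_m(n,1). \] In particular $|p_m(n,-1)|\to\infty$ as $n\to\infty$, and $p_m(n,-1)\neq 0$ for all $n$.
   Context: The $m$-ary partition polynomials $p_m(n,t)$ are defined by the power series expansion $\prod_{j=0}^{\infty}\frac{1}{1-tq^{m^j}}=\sum_{n=0}^{\infty}p_m(n,t)q^n$; in particular $p_m(n,1)$ is the number of partitions of $n$ into powers of $m$. *)

theory Defs
  imports "HOL-Analysis.Analysis" "HOL-Computational_Algebra.Polynomial"
    "HOL-Computational_Algebra.Formal_Power_Series"
begin

text \<open>
  The variable \<open>t\<close> is the polynomial \<open>[:0, 1:]\<close> over the integers and \<open>q\<close> is \<^const>\<open>fps_X\<close>.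
  Integer polynomials carry no \<^const>\<open>inverse\<close>, so \<open>1 / (1 - t q^(m^j))\<close> is written with
  \<open>fps_right_inverse\<close>, whose second argument is the inverse of the constant coefficient.
\<close>

definition mary_factor :: "nat \<Rightarrow> nat \<Rightarrow> int poly fps" where
  "mary_factor m j = fps_right_inverse (1 - fps_const [:0, 1:] * fps_X ^ (m ^ j)) 1"

definition mary_gf :: "nat \<Rightarrow> int poly fps" where
  "mary_gf m = (\<Prod>j. mary_factor m j)"

definition mary_poly :: "nat \<Rightarrow> nat \<Rightarrow> int poly" where
  "mary_poly m n = fps_nth (mary_gf m) n"

lemma mary_factor_inverse:
  assumes "m \<ge> 2"
  shows "(1 - fps_const [:0, 1:] * fps_X ^ (m ^ j)) * mary_factor m j = 1"
  unfolding mary_factor_def using assms by (intro fps_right_inverse) simp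

lemma mary_factor_nth:
  assumes "m \<ge> 2"
  shows "fps_nth (mary_factor m j) k =
    (if k = 0 then 1 else if k < m ^ j then 0 else [:0, 1:] * fps_nth (mary_factor m j) (k - m ^ j))"
proof -
  have "mary_factor m j = 1 + fps_const [:0, 1:] * (fps_X ^ (m ^ j) * mary_factor m j)"
    by (subst mary_factor_inverse[OF assms, of j, symmetric])
       (simp only: left_diff_distrib mult_1_left mult.assoc diff_add_cancel)
  from arg_cong[OF this, of "\<lambda>f. fps_nth f k"]
  have "fps_nth (mary_factor m j) k =
      fps_nth (1 + fps_const [:0, 1:] * (fps_X ^ (m ^ j) * mary_factor m j)) k" .
  also have "\<dots> = (if k = 0 then 1 else if k < m ^ j then 0
      else [:0, 1:] * fps_nth (mary_factor m j) (k - m ^ j))"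
    using assms by (auto simp: fps_X_power_mult_nth)
  finally show ?thesis .
qed

lemma mary_factor_nth_small:
  assumes "m \<ge> 2" "k < m ^ j"
  shows "fps_nth (mary_factor m j) k = (if k = 0 then 1 else 0)"
  by (subst mary_factor_nth[OF assms(1)]) (use assms(2) in simp)

lemma mary_partial_prod_nth:
  assumes "m \<ge> 2" "n \<le> N"
  shows "fps_nth (\<Prod>j\<le>N. mary_factor m j) n = fps_nth (\<Prod>j\<le>n. mary_factor m j) n"
  using assms(2)
proof (induction N rule: dec_induct)
  case (step N)
  have small: "n < m ^ Suc N"
  proof -
    have "n < 2 ^ Suc N" using step.hyps less_exp[of "Suc N"] by linarith
    also have "\<dots> \<le> m ^ Suc N" using assms(1) by (intro power_mono) auto
    finally show ?thesis .
  qed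
  have "fps_nth (\<Prod>j\<le>Suc N. mary_factor m j) n =
      (\<Sum>i=0..n. fps_nth (mary_factor m (Suc N)) i * fps_nth (\<Prod>j\<le>N. mary_factor m j) (n - i))"
    by (simp only: prod.atMost_Suc mult.commute[of _ "mary_factor m (Suc N)"] fps_mult_nth)
  also have "\<dots> = (\<Sum>i=0..n. if i = 0 then fps_nth (\<Prod>j\<le>N. mary_factor m j) n else 0)"
    using small by (intro sum.cong) (simp_all add: mary_factor_nth_small[OF assms(1)])
  finally show ?case using step.IH by simp
qed simp

lemma mary_gf_has_prod:
  assumes "m \<ge> 2"
  shows "mary_factor m has_prod mary_gf m"
proof -
  define P where "P = Abs_fps (\<lambda>n. fps_nth (\<Prod>j\<le>n. mary_factor m j) n)"
  have "(\<lambda>N. \<Prod>j\<le>N. mary_factor m j) \<longlonglongrightarrow> P"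
  proof (rule tendsto_fpsI)
    fix n
    show "\<forall>\<^sub>F N in sequentially. fps_nth (\<Prod>j\<le>N. mary_factor m j) n = fps_nth P n"
      using eventually_ge_at_top[of n]
      by eventually_elim (simp only: P_def fps_nth_Abs_fps, rule mary_partial_prod_nth[OF assms])
  qed
  moreover have "fps_nth P 0 = 1"
    by (use assms in \<open>simp add: P_def mary_factor_nth_small[OF assms]\<close>)
  then have "P \<noteq> 0" by auto
  ultimately have hp: "mary_factor m has_prod P"
    unfolding has_prod_def raw_has_prod_def by simp
  from has_prod_unique[OF this] have "mary_gf m = P"
    unfolding mary_gf_def by (rule sym)
  with hp show ?thesis by (simp only:)
qed

end

theory Submission
  imports Defs
begin

text \<open>
  For odd \<open>m\<close> every part \<open>m^j\<close> is odd, so a partition of \<open>n\<close> into powers of \<open>m\<close> has a number of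
  parts congruent to \<open>n\<close> modulo 2; hence each factor \<open>1 / (1 - t q^(m^j))\<close> is invariant under
  \<open>(t, q) \<mapsto> (-t, -q)\<close>, and so is the product. For the growth at \<open>t = 1\<close>, partitions using only
  the parts 1 and \<open>m\<close> already number \<open>\<lfloor>n / m\<rfloor> + 1\<close>.
\<close>

text \<open>Convergence of formal power series makes each coefficient eventually constant, and the
  coefficient of q^n no longer changes once \<open>N\<close> reaches \<open>n\<close>. All later
  arguments can therefore use finite products.\<close>

lemma mary_poly_eq_partial_prod_nth:
  assumes "m \<ge> 2" "n \<le> N"
  shows "mary_poly m n = fps_nth (\<Prod>j\<le>N. mary_factor m j) n"
proof -
  have "(\<lambda>N. \<Prod>j\<le>N. mary_factor m j) \<longlonglongrightarrow> mary_gf m"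
    using has_prod_imp_tendsto[OF mary_gf_has_prod[OF assms(1)]] .
  then have "\<forall>\<^sub>F M in sequentially. fps_nth (\<Prod>j\<le>M. mary_factor m j) n = fps_nth (mary_gf m) n"
    by (simp add: tendsto_fps_iff)
  then have "\<forall>\<^sub>F M in sequentially. n \<le> M \<and>
      fps_nth (\<Prod>j\<le>M. mary_factor m j) n = fps_nth (mary_gf m) n"
    by (intro eventually_conj eventually_ge_at_top)
  then obtain M where "n \<le> M" "fps_nth (\<Prod>j\<le>M. mary_factor m j) n = fps_nth (mary_gf m) n"
    using eventually_happens'[OF sequentially_bot] by blast
  then show ?thesis
    using mary_partial_prod_nth[OF assms(1)] assms(2) by (metis mary_poly_def)
qed

lemma poly_fps_mult_nth:
  "poly (fps_nth (F * G) n) x = (\<Sum>i=0..n. poly (fps_nth F i) x * poly (fps_nth G (n - i)) x)"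
  by (simp add: fps_mult_nth poly_sum)

text \<open>This is F(-1, q) = F(1, -q), read off coefficientwise: invariance under (t, q) -> (-t,
  -q), specialised to t = 1.\<close>

definition parity_symmetric :: "int poly fps \<Rightarrow> bool" where
  "parity_symmetric F \<longleftrightarrow>
    (\<forall>n. poly (fps_nth F n) (-1) = (-1) ^ n * poly (fps_nth F n) 1)"

lemma parity_symmetric_mult:
  assumes "parity_symmetric F" "parity_symmetric G"
  shows "parity_symmetric (F * G)"
  unfolding parity_symmetric_def
proof
  fix n
  have "poly (fps_nth (F * G) n) (-1)
      = (\<Sum>i=0..n. poly (fps_nth F i) (-1) * poly (fps_nth G (n - i)) (-1))"
    by (rule poly_fps_mult_nth)
  also have "\<dots> = (\<Sum>i=0..n. (-1) ^ n * (poly (fps_nth F i) 1 * poly (fps_nth G (n - i)) 1))"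
  proof (rule sum.cong)
    fix i assume "i \<in> {0..n}"
    then have "(-1) ^ n = (-1 :: int) ^ i * (-1) ^ (n - i)"
      by (simp flip: power_add)
    then show "poly (fps_nth F i) (-1) * poly (fps_nth G (n - i)) (-1)
        = (-1) ^ n * (poly (fps_nth F i) 1 * poly (fps_nth G (n - i)) 1)"
      using assms by (simp add: parity_symmetric_def)
  qed simp
  also have "\<dots> = (-1) ^ n * poly (fps_nth (F * G) n) 1"
    by (simp add: poly_fps_mult_nth sum_distrib_left)
  finally show "poly (fps_nth (F * G) n) (-1) = (-1) ^ n * poly (fps_nth (F * G) n) 1" .
qed

lemma parity_symmetric_1: "parity_symmetric 1"
  by (simp add: parity_symmetric_def)

lemma parity_symmetric_prod:
  assumes "\<And>j. j \<in> A \<Longrightarrow> parity_symmetric (F j)"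
  shows "parity_symmetric (\<Prod>j\<in>A. F j)"
  using assms
  by (induction A rule: infinite_finite_induct)
     (auto intro: parity_symmetric_mult parity_symmetric_1)

text \<open>Induction along the recurrence of \<open>mary_factor_nth\<close>: removing one part
  \<open>m ^ j\<close> divides by t and lowers the exponent by an odd number, so both sides change
  sign.\<close>

lemma parity_symmetric_mary_factor:
  assumes "m \<ge> 2" "odd m"
  shows "parity_symmetric (mary_factor m j)"
  unfolding parity_symmetric_def
proof
  fix k
  show "poly (fps_nth (mary_factor m j) k) (-1) = (-1) ^ k * poly (fps_nth (mary_factor m j) k) 1"
  proof (induction k rule: less_induct)
    case (less k)
    show ?case
    proof (cases "k = 0 \<or> k < m ^ j")
      case True
      then show ?thesis by (auto simp: mary_factor_nth[OF assms(1), of j k])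
    next
      case False
      then have "k - m ^ j < k" using assms by simp
      note IH = less[OF this]
      have "(-1 :: int) ^ k = (-1) ^ (k - m ^ j) * (-1) ^ (m ^ j)"
        using False by (simp flip: power_add)
      also have "\<dots> = - ((-1) ^ (k - m ^ j))"
        using assms(2) by simp
      finally show ?thesis
        using IH False by (simp add: mary_factor_nth[OF assms(1), of j k])
    qed
  qed
qed

text \<open>At t = 1 the factor is the geometric series in q^(m^j).\<close>

lemma mary_factor_nth_at_1:
  assumes "m \<ge> 2"
  shows "poly (fps_nth (mary_factor m j) k) 1 = (if m ^ j dvd k then 1 else 0)"
proof (induction k rule: less_induct)
  case (less k)
  show ?case
  proof (cases "k = 0 \<or> k < m ^ j")
    case True
    then show ?thesis by (auto simp: mary_factor_nth[OF assms, of j k] dest: dvd_imp_le)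
  next
    case False
    then have "k - m ^ j < k" using assms by simp
    from less[OF this] False show ?thesis
      by (simp add: mary_factor_nth[OF assms, of j k] dvd_minus_self)
  qed
qed

lemma mary_factor_prod_nth_nonneg:
  assumes "m \<ge> 2"
  shows "poly (fps_nth (\<Prod>j\<in>A. mary_factor m j) n) 1 \<ge> 0"
proof (induction A arbitrary: n rule: infinite_finite_induct)
  case (insert j A)
  then show ?case
    by (simp add: poly_fps_mult_nth mary_factor_nth_at_1[OF assms] sum_nonneg)
qed simp_all

lemma mary_factor_prod_nth_0:
  assumes "m \<ge> 2"
  shows "fps_nth (\<Prod>j\<in>A. mary_factor m j) 0 = 1"
  by (induction A rule: infinite_finite_induct) (simp_all add: mary_factor_nth[OF assms])

text \<open>Each multiple \<open>i\<close> of \<open>m\<close> up to \<open>n\<close> gives one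
  partition: parts \<open>m\<close> make up \<open>i\<close>, and ones fill the remaining
  \<open>n - i\<close>.\<close>

lemma mary_two_factors_nth_ge:
  assumes "m \<ge> 2"
  shows "poly (fps_nth (mary_factor m 0 * mary_factor m 1) n) 1 \<ge> int (n div m) + 1"
proof -
  have inj: "inj_on (\<lambda>k. k * m) {..n div m}"
    using assms by (auto simp: inj_on_def)
  have sub: "(\<lambda>k. k * m) ` {..n div m} \<subseteq> {i \<in> {0..n}. m dvd i}"
    using assms by (auto simp: less_eq_div_iff_mult_less_eq)
  have "n div m + 1 = card ((\<lambda>k. k * m) ` {..n div m})"
    by (simp add: card_image[OF inj])
  also have "\<dots> \<le> card {i \<in> {0..n}. m dvd i}"
    using sub by (intro card_mono) auto
  finally have "int (n div m) + 1 \<le> int (card {i \<in> {0..n}. m dvd i})"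
    by simp
  also have "\<dots> = (\<Sum>i=0..n. if m dvd i then 1 else 0)"
    by (simp add: sum.If_cases Int_def)
  also have "\<dots> = poly (fps_nth (mary_factor m 1 * mary_factor m 0) n) 1"
    by (simp add: poly_fps_mult_nth mary_factor_nth_at_1[OF assms])
  finally show ?thesis by (simp add: mult.commute)
qed

lemma mary_poly_at_1_ge:
  assumes "m \<ge> 2"
  shows "poly (mary_poly m n) 1 \<ge> int (n div m) + 1"
proof -
  \<comment> \<open>The product runs up to \<open>Suc n\<close>, not \<open>n\<close>, so that
    factor 1 is present even for \<open>n = 0\<close>.\<close>
  let ?F = "mary_factor m 0 * mary_factor m 1" and ?R = "\<Prod>j\<in>{2..Suc n}. mary_factor m j"
  have "{..Suc n} = insert 0 (insert 1 {2..Suc n})"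
    by auto
  then have split: "(\<Prod>j\<le>Suc n. mary_factor m j) = ?F * ?R"
    by (simp add: mult.assoc)
  have F_nonneg: "poly (fps_nth ?F i) 1 \<ge> 0" for i
    using mary_two_factors_nth_ge[OF assms, of i] by linarith
  have R0: "poly (fps_nth ?R 0) 1 = 1"
    by (simp only: mary_factor_prod_nth_0[OF assms] poly_1)
  \<comment> \<open>Only the term \<open>i = n\<close> of the Cauchy product is kept, where
    \<open>?R\<close> contributes its constant coefficient 1; all other terms are
    nonnegative.\<close>
  have "int (n div m) + 1 \<le> poly (fps_nth ?F n) 1 * poly (fps_nth ?R (n - n)) 1"
    using mary_two_factors_nth_ge[OF assms, of n] R0 by simp
  also have "\<dots> \<le> (\<Sum>i=0..n. poly (fps_nth ?F i) 1 * poly (fps_nth ?R (n - i)) 1)"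
    by (intro member_le_sum mult_nonneg_nonneg F_nonneg mary_factor_prod_nth_nonneg[OF assms])
       simp_all
  also have "\<dots> = poly (fps_nth (\<Prod>j\<le>Suc n. mary_factor m j) n) 1"
    unfolding split by (rule poly_fps_mult_nth[symmetric])
  also have "\<dots> = poly (mary_poly m n) 1"
    by (subst mary_poly_eq_partial_prod_nth[OF assms, of n "Suc n"]) simp_all
  finally show ?thesis .
qed

theorem theorem3p6:
  fixes m :: nat
  assumes "m \<ge> 3" and "odd m"
  shows "(\<forall>n. poly (mary_poly m n) (-1) = (-1) ^ n * poly (mary_poly m n) 1)
    \<and> filterlim (\<lambda>n. \<bar>poly (mary_poly m n) (-1)\<bar>) at_top at_top
    \<and> (\<forall>n. poly (mary_poly m n) (-1) \<noteq> 0)"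
proof -
  have m: "m \<ge> 2" using assms(1) by simp
  have sym: "poly (mary_poly m n) (-1) = (-1) ^ n * poly (mary_poly m n) 1" for n
    using parity_symmetric_prod[of "{..n}" "mary_factor m"]
      parity_symmetric_mary_factor[OF m assms(2)]
    by (simp add: mary_poly_eq_partial_prod_nth[OF m order_refl] parity_symmetric_def)
  \<comment> \<open>The sign disappears under the absolute value. This one bound yields both
    divergence and, being at least 1, nonvanishing.\<close>
  have ge: "\<bar>poly (mary_poly m n) (-1)\<bar> \<ge> int (n div m) + 1" for n
    using mary_poly_at_1_ge[OF m, of n] by (simp add: sym abs_mult power_abs)
  have "filterlim (\<lambda>n. \<bar>poly (mary_poly m n) (-1)\<bar>) at_top at_top"
    unfolding filterlim_at_top
  proof
    fix Z :: int
    show "\<forall>\<^sub>F n in at_top. Z \<le> \<bar>poly (mary_poly m n) (-1)\<bar>"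
      \<comment> \<open>From this threshold on \<open>n div m\<close> is at least
        \<open>nat Z\<close>, which is at least \<open>Z\<close> even for negative
        \<open>Z\<close>.\<close>
      using eventually_ge_at_top[of "nat Z * m"]
    proof eventually_elim
      case (elim n)
      then have "nat Z \<le> n div m"
        using m by (simp add: less_eq_div_iff_mult_less_eq)
      then show ?case using ge[of n] by linarith
    qed
  qed
  moreover have "poly (mary_poly m n) (-1) \<noteq> 0" for n
    using ge[of n] by auto
  ultimately show ?thesis using sym by blast
qed

end
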